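(* Let $U$ be a set, $E$ a finite set, and $G=(F,E)$ a covering soft set over $U$, with associated soft covering approximation space $S=(U,C_G)$. Equip $U$ with the topology generated by taking $C_G$ as a subbase, and let $\operatorname{int}$ denote the interior in this topology. Then for every $X\subseteq U$, $S_-(X)\subseteq \operatorname{int}(X)$.
   Context: A soft set over $U$ is a pair $G=(F,E)$ with $F:E\to P(U)$ a map into the power set of $U$. It is a covering soft set if $\bigcup_{e\in E}F(e)=U$ and $F(e)\neq\emptyset$ for every $e\in E$. Write $C_G=\{F(e):e\in E\}$; the pair $S=(U,C_G)$ is called a soft covering approximation space. For $X\subseteq U$ the soft covering lower approximation is $S_-(X)=\bigcup\{F(e): e\in E,\ F(e)\subseteq X\}$. *)

theory Defs
  imports "HOL-Analysis.Analysis"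
begin

text \<open>
  A soft set \<open>(F, E)\<close> over \<open>U\<close> is given by a total function \<open>F\<close> and a parameter set \<open>E\<close>;
  the values of \<open>F\<close> outside \<open>E\<close> play no role in any of the definitions below.
\<close>

definition soft_set :: "'a set \<Rightarrow> ('e \<Rightarrow> 'a set) \<Rightarrow> 'e set \<Rightarrow> bool" where
  "soft_set U F E \<longleftrightarrow> F \<in> E \<rightarrow> Pow U"

definition covering_soft_set :: "'a set \<Rightarrow> ('e \<Rightarrow> 'a set) \<Rightarrow> 'e set \<Rightarrow> bool" where
  "covering_soft_set U F E \<longleftrightarrow>
     soft_set U F E \<and> (\<Union>e\<in>E. F e) = U \<and> (\<forall>e\<in>E. F e \<noteq> {})"

definition soft_cover :: "('e \<Rightarrow> 'a set) \<Rightarrow> 'e set \<Rightarrow> 'a set set" where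
  "soft_cover F E = {F e | e. e \<in> E}"

definition soft_lower_approx :: "('e \<Rightarrow> 'a set) \<Rightarrow> 'e set \<Rightarrow> 'a set \<Rightarrow> 'a set" where
  "soft_lower_approx F E X = \<Union>{F e | e. e \<in> E \<and> F e \<subseteq> X}"

text \<open>
  \<open>topology_generated_by\<close> takes the union of the generating family as its carrier.
  For a covering soft set that union is \<open>U\<close>, so it is a topology on \<open>U\<close>.
\<close>

definition soft_topology :: "('e \<Rightarrow> 'a set) \<Rightarrow> 'e set \<Rightarrow> 'a topology" where
  "soft_topology F E = topology_generated_by (soft_cover F E)"

lemma topspace_soft_topology:
  assumes "covering_soft_set U F E"
  shows "topspace (soft_topology F E) = U"
  using assms
  by (auto simp: soft_topology_def soft_cover_def covering_soft_set_def)

end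

theory Submission
  imports Defs
begin

text \<open>Every \<open>F e\<close> with \<open>e \<in> E\<close> belongs to the subbase and is
  therefore open (\<open>openin_soft_topology\<close>). The lower approximation of \<open>X\<close>
  is a union of such sets, each inside \<open>X\<close>, so it is an open subset of \<open>X\<close>
  and lies in the largest one, the interior.\<close>

lemma openin_soft_topology: "e \<in> E \<Longrightarrow> openin (soft_topology F E) (F e)"
  unfolding soft_topology_def soft_cover_def
  by (rule topology_generated_by_Basis) blast

theorem proposition28:
  fixes U :: "'a set" and F :: "'e \<Rightarrow> 'a set" and E :: "'e set"
  assumes "finite E"
    and "covering_soft_set U F E"
  shows "\<forall>X. X \<subseteq> U \<longrightarrow> soft_lower_approx F E X \<subseteq> soft_topology F E interior_of X"
proof (intro allI impI)
  fix X
  show "soft_lower_approx F E X \<subseteq> soft_topology F E interior_of X"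
  proof (rule interior_of_maximal)
    show "soft_lower_approx F E X \<subseteq> X"
      by (auto simp: soft_lower_approx_def)
    show "openin (soft_topology F E) (soft_lower_approx F E X)"
      \<comment> \<open>Unfolding exposes a union of subbasic sets, so openness of each member
        suffices.\<close>
      unfolding soft_lower_approx_def
      by (rule openin_Union) (auto intro: openin_soft_topology)
  qed
qed

end
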